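(* Let $\mathfrak g_3$ be the complex Lie algebra with basis $\{e_1,e_2,e_3\}$ and only non-zero bracket (up to skew-symmetry) $[e_2,e_3]=-e_2$, and let $\{e_1^*,e_2^*,e_3^*\}$ be the dual basis of $\mathfrak g_3^*$. Then the Lie algebra $\mathfrak g_3\ltimes_{\mathrm{ad}^*}\mathfrak g_3^*$ has basis $\{e_1,e_2,e_3,e_1^*,e_2^*,e_3^*\}$ with non-zero brackets (up to skew-symmetry) $$[e_2,e_3]=-e_2,\quad [e_2,e_2^*]=e_3^*,\quad [e_3,e_2^*]=-e_2^*.$$ Moreover, for all complex parameters $n_{ij}$ subject to the stated restrictions, each of the following is a solution of the classical Yang–Baxter equation on this Lie algebra: - $r_1=n_{32}e_2\otimes e_3^*-e_3^*\otimes n_{32}e_2$; - $r_2=(n_{22}e_2+n_{23}e_3)\otimes e_2^*-\big(\frac{n_{22}^2}{n_{23}}e_2+n_{22}e_3\big)\otimes e_3^*-e_2^*\otimes(n_{22}e_2+n_{23}e_3)+e_3^*\otimes\big(\frac{n_{22}^2}{n_{23}}e_2+n_{22}e_3\big)$, $n_{23}\neq0$; - $r_3=(n_{31}e_1+n_{32}e_2)\otimes e_3^*-e_3^*\otimes(n_{31}e_1+n_{32}e_2)$, $n_{31}\neq0$; - $r_4=n_{21}e_1\otimes e_2^*+n_{31}e_1\otimes e_3^*-e_2^*\otimes n_{21}e_1-e_3^*\otimes n_{31}e_1$, $n_{21}\neq0$; - $r_5=n_{12}e_2\otimes e_1^*+n_{32}e_2\otimes e_3^*-e_1^*\otimes n_{12}e_2-e_3^*\otimes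 n_{32}e_2$, $n_{12}\neq0$; - $r_6=u\otimes e_2^*+v\otimes e_3^*-e_2^*\otimes u-e_3^*\otimes v$, where $u=n_{21}e_1-n_{31}e_2+n_{21}e_3$, $v=n_{31}e_1-\frac{n_{31}^2}{n_{21}}e_2+n_{31}e_3$, $n_{21}\neq0$; - $r_7=u\otimes e_2^*+v\otimes e_3^*-e_2^*\otimes u-e_3^*\otimes v$, where $u=n_{21}e_1-n_{33}e_2-n_{21}e_3$, $v=-n_{33}e_1+\frac{n_{33}^2}{n_{21}}e_2+n_{33}e_3$, $n_{21}\neq0$.
   Context: For a Lie algebra $\mathfrak g$, the coadjoint representation $\mathrm{ad}^*:\mathfrak g\to\mathfrak{gl}(\mathfrak g^* )$ is $\langle\mathrm{ad}^*_x\xi,y\rangle=-\langle\xi,[x,y]\rangle$, and $\mathfrak g\ltimes_{\mathrm{ad}^*}\mathfrak g^*$ is $\mathfrak g\oplus\mathfrak g^*$ with bracket $[x_1+\xi_1,x_2+\xi_2]=[x_1,x_2]+\mathrm{ad}^*_{x_1}\xi_2-\mathrm{ad}^*_{x_2}\xi_1$. An element $r=\sum_i a_i\otimes b_i\in\mathfrak h\otimes\mathfrak h$ of a Lie algebra $\mathfrak h$ is a solution of the classical Yang–Baxter equation (CYBE) in $\mathfrak h$ if $[r_{12},r_{13}]+[r_{12},r_{23}]+[r_{13},r_{23}]=0$ in $U(\mathfrak h)^{\otimes 3}$, where $r_{12}=\sum_i a_i\otimes b_i\otimes1$, $r_{13}=\sum_i a_i\otimes1\otimes b_i$, $r_{23}=\sum_i1\otimes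 a_i\otimes b_i$ and $U(\mathfrak h)$ is the universal enveloping algebra. *)

theory Defs
  imports Complex_Main "HOL-Library.Poly_Mapping"
begin

section \<open>Complex vector spaces, algebras and Lie algebras\<close>

class complex_vector = ab_group_add +
  fixes scaleC :: "complex \<Rightarrow> 'a \<Rightarrow> 'a"  (infixr \<open>*\<^sub>C\<close> 75)
  assumes scaleC_add_right: "c *\<^sub>C (x + y) = c *\<^sub>C x + c *\<^sub>C y"
    and scaleC_add_left: "(c + d) *\<^sub>C x = c *\<^sub>C x + d *\<^sub>C x"
    and scaleC_scaleC: "c *\<^sub>C (d *\<^sub>C x) = (c * d) *\<^sub>C x"
    and scaleC_one: "1 *\<^sub>C x = x"

global_interpretation cvec: vector_space "scaleC :: complex \<Rightarrow> 'a \<Rightarrow> 'a::complex_vector"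
  by unfold_locales (rule scaleC_add_right scaleC_add_left scaleC_scaleC scaleC_one)+

definition is_cbasis :: "'a::complex_vector list \<Rightarrow> bool" where
  "is_cbasis bs \<longleftrightarrow> distinct bs \<and> cvec.independent (set bs) \<and> cvec.span (set bs) = UNIV"

text \<open>Associative unital algebras. The zero algebra is allowed: \<^class>\<open>ring_1\<close> would demand
  \<open>0 \<noteq> 1\<close>.\<close>

class complex_algebra = complex_vector + ring + monoid_mult +
  assumes scaleC_mult_left: "(c *\<^sub>C x) * y = c *\<^sub>C (x * y)"
    and scaleC_mult_right: "x * (c *\<^sub>C y) = c *\<^sub>C (x * y)"

definition commutator :: "'a::complex_algebra \<Rightarrow> 'a \<Rightarrow> 'a" where
  "commutator x y = x * y - y * x"

class complex_lie_algebra = complex_vector +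
  fixes lie_bracket :: "'a \<Rightarrow> 'a \<Rightarrow> 'a"  (\<open>\<lbrakk>_, _\<rbrakk>\<close>)
  assumes bracket_add_left: "\<lbrakk>x + y, z\<rbrakk> = \<lbrakk>x, z\<rbrakk> + \<lbrakk>y, z\<rbrakk>"
    and bracket_add_right: "\<lbrakk>x, y + z\<rbrakk> = \<lbrakk>x, y\<rbrakk> + \<lbrakk>x, z\<rbrakk>"
    and bracket_scaleC_left: "\<lbrakk>c *\<^sub>C x, y\<rbrakk> = c *\<^sub>C \<lbrakk>x, y\<rbrakk>"
    and bracket_scaleC_right: "\<lbrakk>x, c *\<^sub>C y\<rbrakk> = c *\<^sub>C \<lbrakk>x, y\<rbrakk>"
    and bracket_self: "\<lbrakk>x, x\<rbrakk> = 0"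
    and jacobi: "\<lbrakk>x, \<lbrakk>y, z\<rbrakk>\<rbrakk> + \<lbrakk>y, \<lbrakk>z, x\<rbrakk>\<rbrakk> + \<lbrakk>z, \<lbrakk>x, y\<rbrakk>\<rbrakk> = 0"
begin

lemma bracket_skew: "\<lbrakk>x, y\<rbrakk> = - \<lbrakk>y, x\<rbrakk>"
proof -
  have "\<lbrakk>x, y\<rbrakk> + \<lbrakk>y, x\<rbrakk> = 0"
    using bracket_self[of "x + y"] bracket_self[of x] bracket_self[of y]
    by (simp add: bracket_add_left bracket_add_right add.commute)
  then show ?thesis
    by (simp add: eq_neg_iff_add_eq_0)
qed

end

instantiation complex :: complex_vector
begin
definition scaleC_complex :: "complex \<Rightarrow> complex \<Rightarrow> complex" where
  "c *\<^sub>C x = c * (x::complex)"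
instance
  by standard (simp_all add: scaleC_complex_def algebra_simps)
end


section \<open>The dual space\<close>

typedef (overloaded) 'a cdual =
  "{f :: 'a::complex_vector \<Rightarrow> complex. Vector_Spaces.linear scaleC scaleC f}"
  morphisms pairing Abs_cdual
proof
  show "(\<lambda>_. 0) \<in> {f :: 'a \<Rightarrow> complex. Vector_Spaces.linear scaleC scaleC f}"
    by (auto intro!: Vector_Spaces.linear.intro module_hom.intro module_hom_axioms.intro
          cvec.vector_space_axioms cvec.module_axioms)
qed

setup_lifting type_definition_cdual

lemma clinear_iff:
  "Vector_Spaces.linear scaleC scaleC (f :: 'a::complex_vector \<Rightarrow> 'b::complex_vector) \<longleftrightarrow>
     (\<forall>x y. f (x + y) = f x + f y) \<and> (\<forall>c x. f (c *\<^sub>C x) = c *\<^sub>C f x)"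
  by (simp add: Vector_Spaces.linear_iff cvec.vector_space_axioms)

lemma pairing_add: "pairing f (x + y) = pairing f x + pairing f y"
  and pairing_scaleC: "pairing f (c *\<^sub>C x) = c * pairing f x"
  using pairing[of f] by (simp_all add: clinear_iff scaleC_complex_def)

lemma cdual_eqI: "(\<And>x. pairing f x = pairing g x) \<Longrightarrow> f = g"
  by (simp add: pairing_inject[symmetric] fun_eq_iff)

instantiation cdual :: (complex_vector) complex_vector
begin
lift_definition zero_cdual :: "'a cdual" is "\<lambda>_. 0"
  by (simp add: clinear_iff scaleC_complex_def)
lift_definition plus_cdual :: "'a cdual \<Rightarrow> 'a cdual \<Rightarrow> 'a cdual" is "\<lambda>f g x. f x + g x"
  by (simp add: clinear_iff scaleC_complex_def algebra_simps)
lift_definition uminus_cdual :: "'a cdual \<Rightarrow> 'a cdual" is "\<lambda>f x. - f x"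
  by (simp add: clinear_iff scaleC_complex_def)
lift_definition minus_cdual :: "'a cdual \<Rightarrow> 'a cdual \<Rightarrow> 'a cdual" is "\<lambda>f g x. f x - g x"
  by (simp add: clinear_iff scaleC_complex_def algebra_simps)
lift_definition scaleC_cdual :: "complex \<Rightarrow> 'a cdual \<Rightarrow> 'a cdual" is "\<lambda>c f x. c * f x"
  by (simp add: clinear_iff scaleC_complex_def algebra_simps)
instance
  by standard (transfer; simp add: fun_eq_iff algebra_simps)+
end

definition is_dual_cbasis :: "'a::complex_vector list \<Rightarrow> 'a cdual list \<Rightarrow> bool" where
  "is_dual_cbasis bs fs \<longleftrightarrow> is_cbasis bs \<and> length fs = length bs \<and>
     (\<forall>i < length bs. \<forall>j < length bs. pairing (fs ! i) (bs ! j) = (if i = j then 1 else 0))"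


section \<open>The semidirect product with the dual space via the coadjoint representation\<close>

lift_definition coadjoint :: "'g::complex_lie_algebra \<Rightarrow> 'g cdual \<Rightarrow> 'g cdual" is
  "\<lambda>x \<xi> y. - \<xi> \<lbrakk>x, y\<rbrakk>"
  by (simp add: clinear_iff scaleC_complex_def bracket_add_right bracket_scaleC_right)

lemma pairing_coadjoint: "pairing (coadjoint x \<xi>) y = - pairing \<xi> \<lbrakk>x, y\<rbrakk>"
  by transfer simp

declare [[typedef_overloaded]]

datatype ('g::complex_lie_algebra) coadj_double =
  Double (alg_part: 'g) (dual_part: "'g cdual")

instantiation coadj_double :: (complex_lie_algebra) complex_lie_algebra
begin
definition zero_coadj_double :: "'a coadj_double" where
  "0 = Double 0 0"
definition plus_coadj_double :: "'a coadj_double \<Rightarrow> 'a coadj_double \<Rightarrow> 'a coadj_double" where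
  "u + v = Double (alg_part u + alg_part v) (dual_part u + dual_part v)"
definition uminus_coadj_double :: "'a coadj_double \<Rightarrow> 'a coadj_double" where
  "- u = Double (- alg_part u) (- dual_part u)"
definition minus_coadj_double :: "'a coadj_double \<Rightarrow> 'a coadj_double \<Rightarrow> 'a coadj_double" where
  "u - v = Double (alg_part u - alg_part v) (dual_part u - dual_part v)"
definition scaleC_coadj_double :: "complex \<Rightarrow> 'a coadj_double \<Rightarrow> 'a coadj_double" where
  "c *\<^sub>C u = Double (c *\<^sub>C alg_part u) (c *\<^sub>C dual_part u)"
definition lie_bracket_coadj_double :: "'a coadj_double \<Rightarrow> 'a coadj_double \<Rightarrow> 'a coadj_double" where
  "\<lbrakk>u, v\<rbrakk> = Double \<lbrakk>alg_part u, alg_part v\<rbrakk>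
     (coadjoint (alg_part u) (dual_part v) - coadjoint (alg_part v) (dual_part u))"
instance
proof
  have coadjoint_bracket: "coadjoint \<lbrakk>x, y\<rbrakk> \<xi> = coadjoint x (coadjoint y \<xi>) - coadjoint y (coadjoint x \<xi>)"
    for x y :: 'a and \<xi> :: "'a cdual"
  proof (rule cdual_eqI)
    fix z
    have "\<lbrakk>\<lbrakk>x, y\<rbrakk>, z\<rbrakk> = \<lbrakk>x, \<lbrakk>y, z\<rbrakk>\<rbrakk> + \<lbrakk>y, \<lbrakk>z, x\<rbrakk>\<rbrakk>"
      using jacobi[of x y z] bracket_skew[of "\<lbrakk>x, y\<rbrakk>" z] by (metis eq_neg_iff_add_eq_0)
    also have "\<lbrakk>y, \<lbrakk>z, x\<rbrakk>\<rbrakk> = (-1) *\<^sub>C \<lbrakk>y, \<lbrakk>x, z\<rbrakk>\<rbrakk>"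
      using bracket_skew[of z x] bracket_scaleC_right[of y "-1" "\<lbrakk>x, z\<rbrakk>"] by simp
    finally have "pairing \<xi> \<lbrakk>\<lbrakk>x, y\<rbrakk>, z\<rbrakk> = pairing \<xi> \<lbrakk>x, \<lbrakk>y, z\<rbrakk>\<rbrakk> - pairing \<xi> \<lbrakk>y, \<lbrakk>x, z\<rbrakk>\<rbrakk>"
      by (simp only: pairing_add pairing_scaleC) simp
    then show "pairing (coadjoint \<lbrakk>x, y\<rbrakk> \<xi>) z =
        pairing (coadjoint x (coadjoint y \<xi>) - coadjoint y (coadjoint x \<xi>)) z"
      by (simp add: minus_cdual.rep_eq pairing_coadjoint)
  qed
  have coadjoint_linear:
    "coadjoint (x + y) \<xi> = coadjoint x \<xi> + coadjoint y \<xi>"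
    "coadjoint (c *\<^sub>C x) \<xi> = c *\<^sub>C coadjoint x \<xi>"
    "coadjoint x (\<xi> + \<eta>) = coadjoint x \<xi> + coadjoint x \<eta>"
    "coadjoint x (\<xi> - \<eta>) = coadjoint x \<xi> - coadjoint x \<eta>"
    "coadjoint x (c *\<^sub>C \<xi>) = c *\<^sub>C coadjoint x \<xi>" for x y :: 'a and \<xi> \<eta> c
    by (rule cdual_eqI; simp add: plus_cdual.rep_eq minus_cdual.rep_eq scaleC_cdual.rep_eq
          pairing_coadjoint pairing_add pairing_scaleC bracket_add_left bracket_scaleC_left)+
  note defs = zero_coadj_double_def plus_coadj_double_def uminus_coadj_double_def
    minus_coadj_double_def scaleC_coadj_double_def lie_bracket_coadj_double_def
  fix u v w :: "'a coadj_double" and c d :: complex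
  show "u + v + w = u + (v + w)" "u + v = v + u" "0 + u = u" "- u + u = 0" "u - v = u + - v"
    "c *\<^sub>C (u + v) = c *\<^sub>C u + c *\<^sub>C v" "(c + d) *\<^sub>C u = c *\<^sub>C u + d *\<^sub>C u"
    "c *\<^sub>C (d *\<^sub>C u) = (c * d) *\<^sub>C u" "1 *\<^sub>C u = u" "\<lbrakk>u, u\<rbrakk> = 0"
    by (simp_all add: defs algebra_simps scaleC_add_right scaleC_add_left bracket_self)
  show "\<lbrakk>u + v, w\<rbrakk> = \<lbrakk>u, w\<rbrakk> + \<lbrakk>v, w\<rbrakk>" "\<lbrakk>u, v + w\<rbrakk> = \<lbrakk>u, v\<rbrakk> + \<lbrakk>u, w\<rbrakk>"
    by (simp_all add: defs bracket_add_left bracket_add_right coadjoint_linear)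
  show "\<lbrakk>c *\<^sub>C u, v\<rbrakk> = c *\<^sub>C \<lbrakk>u, v\<rbrakk>" "\<lbrakk>u, c *\<^sub>C v\<rbrakk> = c *\<^sub>C \<lbrakk>u, v\<rbrakk>"
    by (simp_all add: defs bracket_scaleC_left bracket_scaleC_right coadjoint_linear
          cvec.scale_right_diff_distrib)
  show "\<lbrakk>u, \<lbrakk>v, w\<rbrakk>\<rbrakk> + \<lbrakk>v, \<lbrakk>w, u\<rbrakk>\<rbrakk> + \<lbrakk>w, \<lbrakk>u, v\<rbrakk>\<rbrakk> = 0"
    by (simp add: defs jacobi coadjoint_linear coadjoint_bracket)
qed
end

abbreviation of_alg :: "'g::complex_lie_algebra \<Rightarrow> 'g coadj_double" where
  "of_alg x \<equiv> Double x 0"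

abbreviation of_dual :: "'g::complex_lie_algebra cdual \<Rightarrow> 'g coadj_double" where
  "of_dual \<xi> \<equiv> Double 0 \<xi>"


section \<open>Free vector spaces\<close>

instantiation poly_mapping :: (type, complex_vector) complex_vector
begin
lift_definition scaleC_poly_mapping :: "complex \<Rightarrow> ('a \<Rightarrow>\<^sub>0 'b) \<Rightarrow> ('a \<Rightarrow>\<^sub>0 'b)" is
  "\<lambda>c f k. c *\<^sub>C f k"
proof -
  fix c and f :: "'a \<Rightarrow> 'b"
  assume "finite {k. f k \<noteq> 0}"
  then show "finite {k. c *\<^sub>C f k \<noteq> 0}"
    by (rule rev_finite_subset) auto
qed
instance
  by standard (transfer; simp add: fun_eq_iff scaleC_add_right scaleC_add_left)+
end

abbreviation free_gen :: "'k \<Rightarrow> 'k \<Rightarrow>\<^sub>0 complex" where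
  "free_gen k \<equiv> Poly_Mapping.single k 1"

definition free_lift :: "('k \<Rightarrow> 'c) \<Rightarrow> ('k \<Rightarrow>\<^sub>0 complex) \<Rightarrow> 'c::complex_vector" where
  "free_lift f p = (\<Sum>k\<in>Poly_Mapping.keys p. Poly_Mapping.lookup p k *\<^sub>C f k)"

lemma free_lift_superset:
  assumes "finite A" "Poly_Mapping.keys p \<subseteq> A"
  shows "free_lift f p = (\<Sum>k\<in>A. Poly_Mapping.lookup p k *\<^sub>C f k)"
  unfolding free_lift_def
  by (rule sum.mono_neutral_left) (use assms in \<open>auto simp: in_keys_iff\<close>)

lemma free_lift_add: "free_lift f (p + q) = free_lift f p + free_lift f q"
proof -
  define A where "A = Poly_Mapping.keys p \<union> Poly_Mapping.keys q"
  have "finite A" "Poly_Mapping.keys p \<subseteq> A" "Poly_Mapping.keys q \<subseteq> A"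
    "Poly_Mapping.keys (p + q) \<subseteq> A"
    using keys_add[of p q] by (auto simp: A_def)
  then show ?thesis
    by (simp add: free_lift_superset[of A] lookup_add scaleC_add_left sum.distrib)
qed

lemma free_lift_scaleC: "free_lift f (c *\<^sub>C p) = c *\<^sub>C free_lift f p"
proof -
  have "Poly_Mapping.keys (c *\<^sub>C p) \<subseteq> Poly_Mapping.keys p"
    by (auto simp: in_keys_iff scaleC_poly_mapping.rep_eq)
  then show ?thesis
    by (simp add: free_lift_superset[of "Poly_Mapping.keys p"] scaleC_poly_mapping.rep_eq
        scaleC_complex_def cvec.scale_sum_right)
qed

lemma free_lift_gen [simp]: "free_lift f (free_gen k) = f k"
  by (simp add: free_lift_def)

lemma free_expand: "p = free_lift free_gen p"
proof (rule poly_mapping_eqI)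
  fix k
  have "Poly_Mapping.lookup (free_lift free_gen p) k =
      (\<Sum>l\<in>Poly_Mapping.keys p. if l = k then Poly_Mapping.lookup p k else 0)"
    unfolding free_lift_def lookup_sum
    by (rule sum.cong)
      (auto simp: scaleC_poly_mapping.rep_eq scaleC_complex_def lookup_single when_def)
  then show "Poly_Mapping.lookup p k = Poly_Mapping.lookup (free_lift free_gen p) k"
    by (simp add: in_keys_iff)
qed


section \<open>Tensor products\<close>

definition tensor_relations ::
    "(('a::complex_vector \<times> 'b::complex_vector) \<Rightarrow>\<^sub>0 complex) set" where
  "tensor_relations =
     {free_gen (x + y, b) - free_gen (x, b) - free_gen (y, b) | x y b. True} \<union>
     {free_gen (a, x + y) - free_gen (a, x) - free_gen (a, y) | a x y. True} \<union>
     {free_gen (c *\<^sub>C a, b) - c *\<^sub>C free_gen (a, b) | c a b. True} \<union>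
     {free_gen (a, c *\<^sub>C b) - c *\<^sub>C free_gen (a, b) | c a b. True}"

lemma congruence_mod_subspace:
  fixes S :: "'v::complex_vector set"
  assumes "cvec.subspace S"
  shows "equivp (\<lambda>p q. p - q \<in> S)"
proof (rule equivpI)
  show "reflp (\<lambda>p q. p - q \<in> S)"
    by (rule reflpI) (simp add: cvec.subspace_0[OF assms])
  show "symp (\<lambda>p q. p - q \<in> S)"
    by (rule sympI) (metis cvec.subspace_neg[OF assms] minus_diff_eq)
  show "transp (\<lambda>p q. p - q \<in> S)"
    by (rule transpI) (metis cvec.subspace_add[OF assms] diff_add_cancel add_diff_eq)
qed

lemma congruence_add:
  fixes S :: "'v::complex_vector set"
  assumes "cvec.subspace S" "p - p' \<in> S" "q - q' \<in> S"
  shows "(p + q) - (p' + q') \<in> S"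
  using cvec.subspace_add[OF assms] by (simp add: algebra_simps)

lemma congruence_diff:
  fixes S :: "'v::complex_vector set"
  assumes "cvec.subspace S" "p - p' \<in> S" "q - q' \<in> S"
  shows "(p - q) - (p' - q') \<in> S"
  using cvec.subspace_diff[OF assms] by (simp add: algebra_simps)

lemma congruence_uminus:
  fixes S :: "'v::complex_vector set"
  assumes "cvec.subspace S" "p - p' \<in> S"
  shows "(- p) - (- p') \<in> S"
  using cvec.subspace_neg[OF assms] by (simp add: algebra_simps)

lemma congruence_scaleC:
  fixes S :: "'v::complex_vector set"
  assumes "cvec.subspace S" "p - p' \<in> S"
  shows "c *\<^sub>C p - c *\<^sub>C p' \<in> S"
  using cvec.subspace_scale[OF assms] by (simp add: cvec.scale_right_diff_distrib)

definition tensor_eq ::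
    "(('a::complex_vector \<times> 'b::complex_vector) \<Rightarrow>\<^sub>0 complex) \<Rightarrow> ('a \<times> 'b \<Rightarrow>\<^sub>0 complex) \<Rightarrow> bool" where
  "tensor_eq p q \<longleftrightarrow> p - q \<in> cvec.span tensor_relations"

quotient_type (overloaded) ('a, 'b) tensor (infixr \<open>\<otimes>\<^sub>t\<close> 21) =
    "('a::complex_vector \<times> 'b::complex_vector) \<Rightarrow>\<^sub>0 complex" / tensor_eq
  unfolding tensor_eq_def[abs_def] by (rule congruence_mod_subspace) (rule cvec.subspace_span)

instantiation tensor :: (complex_vector, complex_vector) complex_vector
begin
lift_definition zero_tensor :: "'a \<otimes>\<^sub>t 'b" is "0" .
lift_definition plus_tensor :: "'a \<otimes>\<^sub>t 'b \<Rightarrow> 'a \<otimes>\<^sub>t 'b \<Rightarrow> 'a \<otimes>\<^sub>t 'b" is "(+)"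
  unfolding tensor_eq_def by (rule congruence_add[OF cvec.subspace_span])
lift_definition uminus_tensor :: "'a \<otimes>\<^sub>t 'b \<Rightarrow> 'a \<otimes>\<^sub>t 'b" is "uminus"
  unfolding tensor_eq_def by (rule congruence_uminus[OF cvec.subspace_span])
lift_definition minus_tensor :: "'a \<otimes>\<^sub>t 'b \<Rightarrow> 'a \<otimes>\<^sub>t 'b \<Rightarrow> 'a \<otimes>\<^sub>t 'b" is "(-)"
  unfolding tensor_eq_def by (rule congruence_diff[OF cvec.subspace_span])
lift_definition scaleC_tensor :: "complex \<Rightarrow> 'a \<otimes>\<^sub>t 'b \<Rightarrow> 'a \<otimes>\<^sub>t 'b" is "scaleC"
  unfolding tensor_eq_def by (rule congruence_scaleC[OF cvec.subspace_span])
instance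
  by standard
    (transfer; simp add: tensor_eq_def scaleC_add_right scaleC_add_left cvec.span_zero)+
end

lift_definition pure_tensor :: "'a::complex_vector \<Rightarrow> 'b::complex_vector \<Rightarrow> 'a \<otimes>\<^sub>t 'b"
  (infixr \<open>\<otimes>\<close> 72) is "\<lambda>a b. free_gen (a, b)" .

lemma tensor_relation_eq: "p - q \<in> tensor_relations \<Longrightarrow> tensor_eq p q"
  by (simp add: tensor_eq_def cvec.span_base)

lemma pure_tensor_add_left: "(x + y) \<otimes> b = x \<otimes> b + y \<otimes> b"
  by transfer (rule tensor_relation_eq, force simp: tensor_relations_def diff_diff_eq)

lemma pure_tensor_add_right: "a \<otimes> (x + y) = a \<otimes> x + a \<otimes> y"
  by transfer (rule tensor_relation_eq, force simp: tensor_relations_def diff_diff_eq)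

lemma pure_tensor_scaleC_left: "(c *\<^sub>C a) \<otimes> b = c *\<^sub>C (a \<otimes> b)"
  by transfer (rule tensor_relation_eq, force simp: tensor_relations_def)

lemma pure_tensor_scaleC_right: "a \<otimes> (c *\<^sub>C b) = c *\<^sub>C (a \<otimes> b)"
  by transfer (rule tensor_relation_eq, force simp: tensor_relations_def)

definition cbilinear :: "('a::complex_vector \<Rightarrow> 'b::complex_vector \<Rightarrow> 'c::complex_vector) \<Rightarrow> bool" where
  "cbilinear f \<longleftrightarrow> (\<forall>b. Vector_Spaces.linear scaleC scaleC (\<lambda>a. f a b)) \<and>
     (\<forall>a. Vector_Spaces.linear scaleC scaleC (f a))"

text \<open>The linear map induced by a bilinear map \<open>f\<close>. It is computed on a chosen representative,
  which is immaterial precisely when \<open>f\<close> is bilinear (lemmas \<open>tensor_lift_pure\<close> and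
  \<open>tensor_lift_linear\<close> below); it is only ever applied to bilinear maps.\<close>

definition tensor_lift ::
    "('a::complex_vector \<Rightarrow> 'b::complex_vector \<Rightarrow> 'c::complex_vector) \<Rightarrow> 'a \<otimes>\<^sub>t 'b \<Rightarrow> 'c" where
  "tensor_lift f t = free_lift (\<lambda>(a, b). f a b) (rep_tensor t)"

lemma cbilinearD:
  assumes "cbilinear f"
  shows "f (a + a') b = f a b + f a' b" "f a (b + b') = f a b + f a b'"
    "f (c *\<^sub>C a) b = c *\<^sub>C f a b" "f a (c *\<^sub>C b) = c *\<^sub>C f a b"
  using assms by (simp_all add: cbilinear_def clinear_iff)

lemma tensor_lift_abs:
  assumes "cbilinear f"
  shows "tensor_lift f (abs_tensor p) = free_lift (\<lambda>(a, b). f a b) p"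
proof -
  let ?L = "free_lift (\<lambda>(a, b). f a b)"
  have diff: "?L (p - q) = ?L p - ?L q" for p q
    using free_lift_add[of "\<lambda>(a, b). f a b" "p - q" q] by (simp add: eq_diff_eq)
  have rel: "?L r = 0" if "r \<in> tensor_relations" for r
    using that by (auto simp: tensor_relations_def diff free_lift_scaleC cbilinearD[OF assms])
  have *: "?L r = 0" if "r \<in> cvec.span tensor_relations" for r
    using that
  proof (induction rule: cvec.span_induct_alt)
    case base
    show ?case by (simp add: free_lift_def)
  next
    case (step c x y)
    then show ?case by (simp add: free_lift_add free_lift_scaleC rel)
  qed
  have "tensor_eq (rep_tensor (abs_tensor p)) p"
    by (rule rep_abs_rsp_left[OF Quotient3_tensor]) (simp add: tensor_eq_def cvec.span_zero)
  then have "?L (rep_tensor (abs_tensor p) - p) = 0"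
    by (intro *) (simp add: tensor_eq_def)
  then show ?thesis
    by (simp add: tensor_lift_def diff)
qed

lemma tensor_lift_pure:
  assumes "cbilinear f"
  shows "tensor_lift f (a \<otimes> b) = f a b"
  by (simp add: pure_tensor.abs_eq tensor_lift_abs[OF assms])

lemma tensor_lift_linear:
  assumes "cbilinear f"
  shows "Vector_Spaces.linear scaleC scaleC (tensor_lift f)"
proof -
  have "tensor_lift f (s + t) = tensor_lift f s + tensor_lift f t" for s t
    by (induction s; induction t)
      (simp add: plus_tensor.abs_eq tensor_lift_abs[OF assms] free_lift_add)
  moreover have "tensor_lift f (c *\<^sub>C s) = c *\<^sub>C tensor_lift f s" for c s
    by (induction s)
      (simp add: scaleC_tensor.abs_eq tensor_lift_abs[OF assms] free_lift_scaleC)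
  ultimately show ?thesis
    by (simp add: clinear_iff)
qed

lemma tensor_induct [case_names pure add]:
  fixes P :: "'a::complex_vector \<otimes>\<^sub>t 'b::complex_vector \<Rightarrow> bool"
  assumes pure: "\<And>a b. P (a \<otimes> b)"
    and add: "\<And>s t. P s \<Longrightarrow> P t \<Longrightarrow> P (s + t)"
  shows "P t"
proof -
  have zero: "P 0"
    using pure[of 0 0] pure_tensor_scaleC_left[of 0 "0::'a" "0::'b"] by simp
  have abs_sum: "abs_tensor (\<Sum>k\<in>A. h k) = (\<Sum>k\<in>A. abs_tensor (h k))"
    for A and h :: "'a \<times> 'b \<Rightarrow> _"
    by (induction A rule: infinite_finite_induct)
      (simp_all add: zero_tensor.abs_eq[symmetric] plus_tensor.abs_eq[symmetric])
  have "P (abs_tensor p)" for p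
  proof -
    have "abs_tensor p =
        (\<Sum>k\<in>Poly_Mapping.keys p. (Poly_Mapping.lookup p k *\<^sub>C fst k) \<otimes> snd k)"
      by (subst free_expand)
        (simp add: free_lift_def abs_sum scaleC_tensor.abs_eq[symmetric]
          pure_tensor_scaleC_left pure_tensor.abs_eq[symmetric, of "fst k" "snd k" for k, simplified])
    moreover have "P (\<Sum>k\<in>A. (Poly_Mapping.lookup p k *\<^sub>C fst k) \<otimes> snd k)" for A
      by (induction A rule: infinite_finite_induct) (simp_all add: zero pure add)
    ultimately show ?thesis by simp
  qed
  then show ?thesis
    by (induction t) simp
qed

instantiation tensor :: (complex_algebra, complex_algebra) complex_algebra
begin

definition one_tensor :: "'a \<otimes>\<^sub>t 'b" where
  "1 = 1 \<otimes> 1"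

text \<open>The product determined by \<open>(a \<otimes> b) * (a' \<otimes> b') = (a * a') \<otimes> (b * b')\<close>.\<close>

definition times_tensor :: "'a \<otimes>\<^sub>t 'b \<Rightarrow> 'a \<otimes>\<^sub>t 'b \<Rightarrow> 'a \<otimes>\<^sub>t 'b" where
  "s * t = tensor_lift (\<lambda>a b. tensor_lift (\<lambda>a' b'. (a * a') \<otimes> (b * b')) t) s"

lemma tensor_mult_inner: "cbilinear (\<lambda>a' b'. ((a::'a) * a') \<otimes> ((b::'b) * b'))"
  by (simp add: cbilinear_def clinear_iff distrib_left scaleC_mult_right
      pure_tensor_add_left pure_tensor_add_right pure_tensor_scaleC_left pure_tensor_scaleC_right)

lemma tensor_mult_outer:
  "cbilinear (\<lambda>(a::'a) (b::'b). tensor_lift (\<lambda>a' b'. (a * a') \<otimes> (b * b')) t)"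
proof -
  define F where "F = (\<lambda>(a::'a) (b::'b). tensor_lift (\<lambda>a' b'. (a * a') \<otimes> (b * b')))"
  have F: "F a b (a' \<otimes> b') = (a * a') \<otimes> (b * b')" "F a b (s + t) = F a b s + F a b t"
    for a a' b b' s t
    unfolding F_def using tensor_lift_linear[OF tensor_mult_inner]
    by (simp_all add: tensor_lift_pure[OF tensor_mult_inner] clinear_iff)
  note pure = pure_tensor_add_left pure_tensor_add_right pure_tensor_scaleC_left
    pure_tensor_scaleC_right
  have "F (x + y) b t = F x b t + F y b t" "F a (z + w) t = F a z t + F a w t"
    "F (c *\<^sub>C a) b t = c *\<^sub>C F a b t" "F a (c *\<^sub>C b) t = c *\<^sub>C F a b t" for x y z w a b c
    by (induction t rule: tensor_induct;
        simp add: F distrib_right scaleC_mult_left pure scaleC_add_right)+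
  then have "cbilinear (\<lambda>a b. F a b t)"
    by (simp add: cbilinear_def clinear_iff)
  then show ?thesis
    by (simp add: F_def)
qed

lemma tensor_mult_left:
  "((a::'a) \<otimes> (b::'b)) * t = tensor_lift (\<lambda>a' b'. (a * a') \<otimes> (b * b')) t"
  unfolding times_tensor_def by (rule tensor_lift_pure[OF tensor_mult_outer])

lemma tensor_mult_pure: "((a::'a) \<otimes> (b::'b)) * (a' \<otimes> b') = (a * a') \<otimes> (b * b')"
  unfolding tensor_mult_left by (rule tensor_lift_pure[OF tensor_mult_inner])

lemma tensor_mult_linear:
  fixes s t u :: "'a \<otimes>\<^sub>t 'b"
  shows "(s + t) * u = s * u + t * u" "u * (s + t) = u * s + u * t"
    "(c *\<^sub>C s) * u = c *\<^sub>C (s * u)" "u * (c *\<^sub>C s) = c *\<^sub>C (u * s)"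
proof -
  show left: "(s + t) * u = s * u + t * u" "(c *\<^sub>C s) * u = c *\<^sub>C (s * u)" for s t u :: "'a \<otimes>\<^sub>t 'b"
    using tensor_lift_linear[OF tensor_mult_outer] by (simp_all add: times_tensor_def clinear_iff)
  have pure: "(a \<otimes> b) * (s + t) = (a \<otimes> b) * s + (a \<otimes> b) * t"
    "(a \<otimes> b) * (c *\<^sub>C s) = c *\<^sub>C ((a \<otimes> b) * s)" for a :: 'a and b :: 'b
    unfolding tensor_mult_left
    using tensor_lift_linear[OF tensor_mult_inner] by (simp_all add: clinear_iff)
  show "u * (s + t) = u * s + u * t"
    by (induction u rule: tensor_induct) (simp_all add: left pure)
  show "u * (c *\<^sub>C s) = c *\<^sub>C (u * s)"
    by (induction u rule: tensor_induct) (simp_all add: left pure scaleC_add_right)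
qed

instance
proof
  fix s t u :: "'a \<otimes>\<^sub>t 'b" and c :: complex
  note lin = tensor_mult_linear
  show "(s + t) * u = s * u + t * u" "u * (s + t) = u * s + u * t"
    "(c *\<^sub>C s) * u = c *\<^sub>C (s * u)" "u * (c *\<^sub>C s) = c *\<^sub>C (u * s)"
    by (rule lin)+
  show "1 * s = s" "s * 1 = s"
    by (induction s rule: tensor_induct; simp add: one_tensor_def tensor_mult_pure lin)+
  show "s * t * u = s * (t * u)"
  proof (induction s rule: tensor_induct)
    case (pure a b)
    show ?case
    proof (induction t rule: tensor_induct)
      case (pure a' b')
      show ?case
        by (induction u rule: tensor_induct) (simp_all add: tensor_mult_pure lin mult.assoc)
    qed (simp add: lin)
  qed (simp add: lin)
qed

end


section \<open>The universal enveloping algebra\<close>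

datatype 'a word = Word (letters: "'a list")

instantiation word :: (type) monoid_add
begin
definition zero_word :: "'a word" where "0 = Word []"
definition plus_word :: "'a word \<Rightarrow> 'a word \<Rightarrow> 'a word" where
  "v + w = Word (letters v @ letters w)"
instance
  by standard (simp_all add: zero_word_def plus_word_def)
end

text \<open>The free associative unital algebra on the set \<open>'a\<close> is the monoid algebra
  \<open>'a word \<Rightarrow>\<^sub>0 complex\<close>, with the convolution product provided by \<^type>\<open>poly_mapping\<close>.\<close>

lemma scaleC_eq_single_mult: "c *\<^sub>C p = Poly_Mapping.single 0 c * p"
  for p :: "'a::monoid_add \<Rightarrow>\<^sub>0 complex"
proof -
  have "c *\<^sub>C p = Poly_Mapping.map ((*) c) p"
    by (rule poly_mapping_eqI)
      (simp add: scaleC_poly_mapping.rep_eq scaleC_complex_def Poly_Mapping.map.rep_eq when_def)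
  then show ?thesis
    by (simp add: mult_map_scale_conv_mult)
qed

lemma single_scalar_commute: "p * Poly_Mapping.single 0 c = Poly_Mapping.single 0 c * p"
  for p :: "'a::monoid_add \<Rightarrow>\<^sub>0 complex"
proof -
  have "(\<Sum>k\<in>A. Poly_Mapping.single k (h k)) * Poly_Mapping.single 0 c =
      Poly_Mapping.single 0 c * (\<Sum>k\<in>A. Poly_Mapping.single k (h k))"
    for A :: "'a set" and h :: "'a \<Rightarrow> complex"
    by (simp add: sum_distrib_left sum_distrib_right mult_single mult.commute)
  moreover have "p = (\<Sum>k\<in>Poly_Mapping.keys p. Poly_Mapping.single k (Poly_Mapping.lookup p k))"
    by (subst free_expand)
      (simp add: free_lift_def scaleC_eq_single_mult mult_single)
  ultimately show ?thesis
    by metis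
qed

lemma free_algebra_scaleC_mult:
  fixes p q :: "'a::monoid_add \<Rightarrow>\<^sub>0 complex"
  shows "(c *\<^sub>C p) * q = c *\<^sub>C (p * q)" "p * (c *\<^sub>C q) = c *\<^sub>C (p * q)"
  by (simp_all add: scaleC_eq_single_mult mult.assoc[symmetric] single_scalar_commute)

abbreviation letter :: "'a \<Rightarrow> ('a word \<Rightarrow>\<^sub>0 complex)" where
  "letter x \<equiv> free_gen (Word [x])"

text \<open>The first two families of relations make the generators depend linearly on the elements of
  the Lie algebra, which turns the free algebra on its underlying set into its tensor algebra.\<close>

definition uea_relations :: "('a::complex_lie_algebra word \<Rightarrow>\<^sub>0 complex) set" where
  "uea_relations =
     {letter (x + y) - letter x - letter y | x y. True} \<union>
     {letter (c *\<^sub>C x) - c *\<^sub>C letter x | c x. True} \<union>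
     {letter x * letter y - letter y * letter x - letter \<lbrakk>x, y\<rbrakk> | x y. True}"

definition uea_ideal :: "('a::complex_lie_algebra word \<Rightarrow>\<^sub>0 complex) set" where
  "uea_ideal = cvec.span {p * r * q | p r q. r \<in> uea_relations}"

lemma uea_ideal_subspace: "cvec.subspace uea_ideal"
  by (simp add: uea_ideal_def)

lemma uea_ideal_mult:
  assumes "z \<in> uea_ideal"
  shows "p * z * q \<in> uea_ideal"
  using assms unfolding uea_ideal_def
proof (induction rule: cvec.span_induct_alt)
  case base
  show ?case by (simp add: cvec.span_zero)
next
  case (step c x y)
  from step obtain p' r q' where "x = p' * r * q'" "r \<in> uea_relations" by blast
  then have "p * x * q = (p * p') * r * (q' * q)" by (simp add: mult.assoc)
  with \<open>r \<in> uea_relations\<close> have "p * x * q \<in> cvec.span {p * r * q | p r q. r \<in> uea_relations}"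
    by (intro cvec.span_base) blast
  with step show ?case
    by (simp add: distrib_left distrib_right free_algebra_scaleC_mult cvec.span_add cvec.span_scale)
qed

definition uea_eq ::
    "('a::complex_lie_algebra word \<Rightarrow>\<^sub>0 complex) \<Rightarrow> ('a word \<Rightarrow>\<^sub>0 complex) \<Rightarrow> bool" where
  "uea_eq p q \<longleftrightarrow> p - q \<in> uea_ideal"

quotient_type (overloaded) 'a uea = "'a::complex_lie_algebra word \<Rightarrow>\<^sub>0 complex" / uea_eq
  unfolding uea_eq_def[abs_def] by (rule congruence_mod_subspace) (rule uea_ideal_subspace)

instantiation uea :: (complex_lie_algebra) complex_algebra
begin
lift_definition zero_uea :: "'a uea" is "0" .
lift_definition one_uea :: "'a uea" is "1" .
lift_definition plus_uea :: "'a uea \<Rightarrow> 'a uea \<Rightarrow> 'a uea" is "(+)"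
  unfolding uea_eq_def by (rule congruence_add[OF uea_ideal_subspace])
lift_definition uminus_uea :: "'a uea \<Rightarrow> 'a uea" is "uminus"
  unfolding uea_eq_def by (rule congruence_uminus[OF uea_ideal_subspace])
lift_definition minus_uea :: "'a uea \<Rightarrow> 'a uea \<Rightarrow> 'a uea" is "(-)"
  unfolding uea_eq_def by (rule congruence_diff[OF uea_ideal_subspace])
lift_definition scaleC_uea :: "complex \<Rightarrow> 'a uea \<Rightarrow> 'a uea" is "scaleC"
  unfolding uea_eq_def by (rule congruence_scaleC[OF uea_ideal_subspace])
lift_definition times_uea :: "'a uea \<Rightarrow> 'a uea \<Rightarrow> 'a uea" is "(*)"
proof -
  fix p p' q q' :: "'a word \<Rightarrow>\<^sub>0 complex"
  assume "uea_eq p p'" "uea_eq q q'"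
  then have "1 * (p - p') * q + p' * (q - q') * 1 \<in> uea_ideal"
    unfolding uea_eq_def by (intro cvec.subspace_add[OF uea_ideal_subspace] uea_ideal_mult)
  then show "uea_eq (p * q) (p' * q')"
    by (simp add: uea_eq_def algebra_simps)
qed
instance
  by standard
    (transfer; simp add: uea_eq_def scaleC_add_right scaleC_add_left algebra_simps
      free_algebra_scaleC_mult cvec.subspace_0[OF uea_ideal_subspace])+
end

lift_definition uea_incl :: "'a::complex_lie_algebra \<Rightarrow> 'a uea" is letter .


section \<open>The classical Yang--Baxter equation\<close>

text \<open>The type \<open>'h uea \<otimes>\<^sub>t 'h uea \<otimes>\<^sub>t 'h uea\<close> is \<open>U(h) \<otimes> (U(h) \<otimes> U(h))\<close>. The three maps
  below are the linear maps on \<open>h \<otimes> h\<close> sending \<open>a \<otimes> b\<close> to \<open>a \<otimes> b \<otimes> 1\<close>, \<open>a \<otimes> 1 \<otimes> b\<close> and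
  \<open>1 \<otimes> a \<otimes> b\<close>.\<close>

definition leg12 :: "'h::complex_lie_algebra \<otimes>\<^sub>t 'h \<Rightarrow> 'h uea \<otimes>\<^sub>t 'h uea \<otimes>\<^sub>t 'h uea" where
  "leg12 = tensor_lift (\<lambda>a b. uea_incl a \<otimes> uea_incl b \<otimes> 1)"

definition leg13 :: "'h::complex_lie_algebra \<otimes>\<^sub>t 'h \<Rightarrow> 'h uea \<otimes>\<^sub>t 'h uea \<otimes>\<^sub>t 'h uea" where
  "leg13 = tensor_lift (\<lambda>a b. uea_incl a \<otimes> 1 \<otimes> uea_incl b)"

definition leg23 :: "'h::complex_lie_algebra \<otimes>\<^sub>t 'h \<Rightarrow> 'h uea \<otimes>\<^sub>t 'h uea \<otimes>\<^sub>t 'h uea" where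
  "leg23 = tensor_lift (\<lambda>a b. 1 \<otimes> uea_incl a \<otimes> uea_incl b)"

definition solves_CYBE :: "'h::complex_lie_algebra \<otimes>\<^sub>t 'h \<Rightarrow> bool" where
  "solves_CYBE r \<longleftrightarrow>
     commutator (leg12 r) (leg13 r) + commutator (leg12 r) (leg23 r) +
     commutator (leg13 r) (leg23 r) = 0"


section \<open>A model of the three-dimensional Lie algebra\<close>

text \<open>The Lie algebra with basis \<open>e\<^sub>1, e\<^sub>2, e\<^sub>3\<close> and single non-zero bracket
  \<open>[e\<^sub>2, e\<^sub>3] = - e\<^sub>2\<close> is determined by this description up to isomorphism, so statements about it
  quantify over all Lie algebras with such a basis. The type below shows that one exists.\<close>

datatype g3 = G3 (crd1: complex) (crd2: complex) (crd3: complex)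

instantiation g3 :: complex_lie_algebra
begin
definition zero_g3 :: g3 where "0 = G3 0 0 0"
definition plus_g3 :: "g3 \<Rightarrow> g3 \<Rightarrow> g3" where
  "x + y = G3 (crd1 x + crd1 y) (crd2 x + crd2 y) (crd3 x + crd3 y)"
definition uminus_g3 :: "g3 \<Rightarrow> g3" where "- x = G3 (- crd1 x) (- crd2 x) (- crd3 x)"
definition minus_g3 :: "g3 \<Rightarrow> g3 \<Rightarrow> g3" where
  "x - y = G3 (crd1 x - crd1 y) (crd2 x - crd2 y) (crd3 x - crd3 y)"
definition scaleC_g3 :: "complex \<Rightarrow> g3 \<Rightarrow> g3" where
  "c *\<^sub>C x = G3 (c * crd1 x) (c * crd2 x) (c * crd3 x)"
definition lie_bracket_g3 :: "g3 \<Rightarrow> g3 \<Rightarrow> g3" where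
  "\<lbrakk>x, y\<rbrakk> = G3 0 (crd3 x * crd2 y - crd2 x * crd3 y) 0"
instance
  by standard (simp_all add: zero_g3_def plus_g3_def uminus_g3_def minus_g3_def scaleC_g3_def
      lie_bracket_g3_def algebra_simps)
end

lemma g3_exists:
  "\<exists>(e1::g3) e2 e3 f1 f2 f3. is_cbasis [e1, e2, e3] \<and>
     \<lbrakk>e1, e2\<rbrakk> = 0 \<and> \<lbrakk>e1, e3\<rbrakk> = 0 \<and> \<lbrakk>e2, e3\<rbrakk> = - e2 \<and>
     is_dual_cbasis [e1, e2, e3] [f1, f2, f3]"
proof -
  note defs = zero_g3_def plus_g3_def uminus_g3_def minus_g3_def scaleC_g3_def lie_bracket_g3_def
  define e1 e2 e3 where e: "e1 = G3 1 0 0" "e2 = G3 0 1 0" "e3 = G3 0 0 1"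
  have basis: "is_cbasis [e1, e2, e3]"
    unfolding is_cbasis_def
  proof (intro conjI)
    show "distinct [e1, e2, e3]" by (simp add: e)
    show "cvec.independent (set [e1, e2, e3])"
      by (auto simp: cvec.independent_insert cvec.span_insert cvec.span_singleton e defs)
    have "x = crd1 x *\<^sub>C e1 + crd2 x *\<^sub>C e2 + crd3 x *\<^sub>C e3" for x
      by (simp add: e defs)
    moreover have "crd1 x *\<^sub>C e1 + crd2 x *\<^sub>C e2 + crd3 x *\<^sub>C e3 \<in> cvec.span (set [e1, e2, e3])" for x
      by (intro cvec.span_add cvec.span_scale cvec.span_base) simp_all
    ultimately show "cvec.span (set [e1, e2, e3]) = UNIV"
      by (metis UNIV_eq_I)
  qed
  have lin: "Vector_Spaces.linear scaleC scaleC f" if "f \<in> {crd1, crd2, crd3}" for f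
    using that by (auto simp: clinear_iff defs scaleC_complex_def)
  have "is_dual_cbasis [e1, e2, e3] [Abs_cdual crd1, Abs_cdual crd2, Abs_cdual crd3]"
    using basis by (auto simp: is_dual_cbasis_def Abs_cdual_inverse lin e less_Suc_eq)
  with basis show ?thesis
    by (intro exI conjI) (assumption | simp add: e defs)+
qed

end

theory Submission
  imports Defs
begin

text \<open>Each of the seven tensors is a bivector \<open>x \<otimes> y - y \<otimes> x\<close> with \<open>\<lbrakk>x, y\<rbrakk> = c *\<^sub>C y\<close>. For a
  skew-symmetric tensor the left-hand side of the Yang--Baxter equation is the alternating
  Schouten bracket, and on the span of \<open>x\<close> and \<open>y\<close>, a subalgebra of dimension at most two, there
  are no non-zero trivectors; concretely, the six surviving terms cancel in pairs.\<close>

section \<open>Bases of the double of a Lie algebra with its dual space\<close>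

text \<open>A functional that kills all other members of \<open>S\<close> kills their span, so a
  vector on which it is non-zero cannot lie there. Each vector may come with its own
  functional.\<close>

lemma cvec_independentI:
  fixes S :: "'v::complex_vector set"
  assumes "\<And>v. v \<in> S \<Longrightarrow> \<exists>\<phi> :: 'v \<Rightarrow> complex.
      Vector_Spaces.linear scaleC scaleC \<phi> \<and> \<phi> v \<noteq> 0 \<and> (\<forall>w \<in> S - {v}. \<phi> w = 0)"
  shows "cvec.independent S"
proof
  assume "cvec.dependent S"
  then obtain v where v: "v \<in> S" "v \<in> cvec.span (S - {v})"
    by (auto simp: cvec.dependent_def)
  obtain \<phi> :: "'v \<Rightarrow> complex" where lin: "Vector_Spaces.linear scaleC scaleC \<phi>"
    and "\<phi> v \<noteq> 0" and zero: "\<forall>w \<in> S - {v}. \<phi> w = 0"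
    using assms[OF v(1)] by blast
  have add: "\<phi> (x + y) = \<phi> x + \<phi> y" and scale: "\<phi> (c *\<^sub>C x) = c * \<phi> x" for x y c
    using lin by (simp_all add: clinear_iff scaleC_complex_def)
  have "\<phi> v = 0"
    using v(2)
  proof (induction rule: cvec.span_induct_alt)
    case base
    show ?case using scale[of 0 0] by simp
  next
    case (step c x y)
    then show ?case using zero by (simp add: add scale)
  qed
  with \<open>\<phi> v \<noteq> 0\<close> show False by simp
qed

lemma pairing_zero [simp]: "pairing f 0 = 0"
  using pairing_scaleC[of f 0 0] by simp

lemma pairing_uminus [simp]: "pairing f (- x) = - pairing f x"
  using pairing_scaleC[of f "-1" x] by simp

lemma cdual_eqI_basis:
  assumes "is_cbasis bs" "\<And>b. b \<in> set bs \<Longrightarrow> pairing f b = pairing g b"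
  shows "f = g"
proof (rule cdual_eqI)
  fix x
  have "x \<in> cvec.span (set bs)"
    using assms(1) by (simp add: is_cbasis_def)
  then show "pairing f x = pairing g x"
    by (induction rule: cvec.span_induct_alt) (simp_all add: pairing_add pairing_scaleC assms(2))
qed

lemma pairing_sum_scaleC:
  "pairing (\<Sum>i\<in>A. c i *\<^sub>C f i) x = (\<Sum>i\<in>A. c i * pairing (f i) x)"
  by (induction A rule: infinite_finite_induct)
    (simp_all add: zero_cdual.rep_eq plus_cdual.rep_eq scaleC_cdual.rep_eq)

text \<open>The two families serve as coordinate functionals for each other: pairing the algebra
  part with \<open>fs ! i\<close>, or evaluating the dual part at \<open>bs ! i\<close>, singles out
  one vector of the list. The span is everything because both components expand in their own
  family.\<close>

lemma is_cbasis_coadj_double: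
  fixes bs :: "'g::complex_lie_algebra list"
  assumes "is_dual_cbasis bs fs"
  shows "is_cbasis (map of_alg bs @ map of_dual fs)"
proof -
  have basis: "is_cbasis bs" and len: "length fs = length bs"
    and pair: "\<And>i j. i < length bs \<Longrightarrow> j < length bs \<Longrightarrow>
      pairing (fs ! i) (bs ! j) = (if i = j then 1 else 0)"
    using assms by (auto simp: is_dual_cbasis_def)
  let ?S = "set (map of_alg bs @ map of_dual fs)"
  note defs = zero_coadj_double_def plus_coadj_double_def scaleC_coadj_double_def
  have dist_fs: "distinct fs"
    unfolding distinct_conv_nth by (metis pair len zero_neq_one)
  \<comment> \<open>Keeps the two halves of the list disjoint: \<open>of_alg b = of_dual f\<close>
    would force \<open>b = 0\<close>.\<close>
  have "0 \<notin> set bs"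
    by (metis pair in_set_conv_nth pairing_zero zero_neq_one)
  then have "distinct (map of_alg bs @ map of_dual fs)"
    using basis dist_fs by (auto simp: is_cbasis_def distinct_map inj_on_def)
  moreover have "cvec.independent ?S"
  proof (rule cvec_independentI)
    fix v assume "v \<in> ?S"
    then consider (alg) i where "i < length bs" "v = of_alg (bs ! i)"
      | (dual) i where "i < length bs" "v = of_dual (fs ! i)"
      by (auto simp: in_set_conv_nth len)
    then show "\<exists>\<phi> :: 'g coadj_double \<Rightarrow> complex.
        Vector_Spaces.linear scaleC scaleC \<phi> \<and> \<phi> v \<noteq> 0 \<and> (\<forall>w \<in> ?S - {v}. \<phi> w = 0)"
    proof cases
      case alg
      \<comment> \<open>Vanishes on every \<open>of_dual\<close> because the algebra part there is
        0, and on the other \<open>of_alg\<close> vectors by duality.\<close>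
      let ?\<phi> = "\<lambda>u. pairing (fs ! i) (alg_part u)"
      have "Vector_Spaces.linear scaleC scaleC ?\<phi>"
        by (simp add: clinear_iff defs pairing_add pairing_scaleC scaleC_complex_def)
      moreover have "?\<phi> w = 0" if "w \<in> ?S - {v}" for w
        using that alg pair by (auto simp: in_set_conv_nth split: if_splits)
      ultimately show ?thesis
        using alg pair by (intro exI[of _ ?\<phi>]) auto
    next
      case dual
      let ?\<phi> = "\<lambda>u. pairing (dual_part u) (bs ! i)"
      have "Vector_Spaces.linear scaleC scaleC ?\<phi>"
        by (simp add: clinear_iff defs plus_cdual.rep_eq scaleC_cdual.rep_eq scaleC_complex_def)
      moreover have "?\<phi> w = 0" if "w \<in> ?S - {v}" for w
        using that dual len pair
        by (auto simp: in_set_conv_nth zero_cdual.rep_eq split: if_splits)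
      ultimately show ?thesis
        using dual pair by (intro exI[of _ ?\<phi>]) auto
    qed
  qed
  moreover have "u \<in> cvec.span ?S" for u
  proof -
    have alg: "of_alg x \<in> cvec.span ?S" for x
    proof -
      have "x \<in> cvec.span (set bs)"
        using basis by (simp add: is_cbasis_def)
      then show ?thesis
      proof (induction rule: cvec.span_induct_alt)
        case base
        show ?case using cvec.span_zero[of ?S] by (simp only: zero_coadj_double_def)
      next
        case (step c x y)
        have "of_alg (c *\<^sub>C x + y) = c *\<^sub>C of_alg x + of_alg y"
          by (simp add: defs)
        moreover have "of_alg x \<in> cvec.span ?S"
          using step by (intro cvec.span_base) auto
        ultimately show ?case
          using step by (simp only: cvec.span_add cvec.span_scale)
      qed
    qed
    have of_dual_linear: "of_dual 0 = 0" "of_dual (\<xi> + \<eta>) = of_dual \<xi> + of_dual \<eta>"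
      "of_dual (c *\<^sub>C \<xi>) = c *\<^sub>C of_dual \<xi>" for \<xi> \<eta> :: "'g cdual" and c
      by (simp_all add: defs)
    have dual_sum: "of_dual (\<Sum>i\<in>A. c i *\<^sub>C f i) = (\<Sum>i\<in>A. c i *\<^sub>C of_dual (f i))"
      for A :: "nat set" and c and f :: "nat \<Rightarrow> 'g cdual"
      by (induction A rule: infinite_finite_induct) (simp_all add: of_dual_linear)
    \<comment> \<open>The coordinates of a functional in the dual basis are its values on the basis,
      so it suffices to compare both sides on \<open>bs\<close>.\<close>
    have expand: "\<xi> = (\<Sum>i<length bs. pairing \<xi> (bs ! i) *\<^sub>C fs ! i)" for \<xi>
      by (rule cdual_eqI_basis[OF basis])
        (auto simp: in_set_conv_nth pairing_sum_scaleC pair if_distrib cong: if_cong)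
    have dual_expand:
      "of_dual \<xi> = (\<Sum>i<length bs. pairing \<xi> (bs ! i) *\<^sub>C of_dual (fs ! i))" for \<xi>
      using arg_cong[OF expand, where f = of_dual] unfolding dual_sum .
    have dual: "of_dual \<xi> \<in> cvec.span ?S" for \<xi>
      unfolding dual_expand[of \<xi>]
      by (intro cvec.span_sum cvec.span_scale cvec.span_base) (simp add: len)
    have "u = of_alg (alg_part u) + of_dual (dual_part u)"
      by (simp add: defs)
    then show ?thesis
      using cvec.span_add[OF alg dual, of "alg_part u" "dual_part u"] by simp
  qed
  ultimately show ?thesis
    by (auto simp: is_cbasis_def)
qed

section \<open>The enveloping algebra and the legs of a tensor\<close>

text \<open>For each equation, the representatives of the two sides differ by one defining relation,
  which lies in the ideal.\<close>

lemma uea_incl_add: "uea_incl (x + y) = uea_incl x + uea_incl y"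
  and uea_incl_scaleC: "uea_incl (c *\<^sub>C x) = c *\<^sub>C uea_incl x"
  and commutator_uea_incl: "commutator (uea_incl x) (uea_incl y) = uea_incl \<lbrakk>x, y\<rbrakk>"
proof -
  have rel: "r \<in> uea_ideal" if "r \<in> uea_relations" for r :: "'a word \<Rightarrow>\<^sub>0 complex"
  proof -
    have "r = 1 * r * 1" by simp
    with that show ?thesis
      unfolding uea_ideal_def by (intro cvec.span_base) blast
  qed
  show "uea_incl (x + y) = uea_incl x + uea_incl y"
    by transfer
      \<comment> \<open>Subtracting a sum is split into two subtractions, the shape in which the
        additivity relation is listed.\<close>
      (simp only: uea_eq_def diff_diff_eq[symmetric], rule rel, unfold uea_relations_def, blast)
  show "uea_incl (c *\<^sub>C x) = c *\<^sub>C uea_incl x"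
    by transfer (simp only: uea_eq_def, rule rel, unfold uea_relations_def, blast)
  show "commutator (uea_incl x) (uea_incl y) = uea_incl \<lbrakk>x, y\<rbrakk>"
    unfolding commutator_def
    by transfer (simp only: uea_eq_def, rule rel, unfold uea_relations_def, blast)
qed

lemmas pure_tensor_linear =
  pure_tensor_add_left pure_tensor_add_right pure_tensor_scaleC_left pure_tensor_scaleC_right

text \<open>Bilinearity makes \<open>tensor_lift\<close> independent of the chosen representative,
  so that the legs can be evaluated on pure tensors and are linear.\<close>

lemma cbilinear_legs:
  "cbilinear (\<lambda>a b. uea_incl a \<otimes> uea_incl b \<otimes> 1)"
  "cbilinear (\<lambda>a b. uea_incl a \<otimes> 1 \<otimes> uea_incl b)"
  "cbilinear (\<lambda>a b. 1 \<otimes> uea_incl a \<otimes> uea_incl b)"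
  by (simp_all add: cbilinear_def clinear_iff uea_incl_add uea_incl_scaleC pure_tensor_linear)

lemma leg_pure:
  "leg12 (a \<otimes> b) = uea_incl a \<otimes> uea_incl b \<otimes> 1"
  "leg13 (a \<otimes> b) = uea_incl a \<otimes> 1 \<otimes> uea_incl b"
  "leg23 (a \<otimes> b) = 1 \<otimes> uea_incl a \<otimes> uea_incl b"
  by (simp_all add: leg12_def leg13_def leg23_def tensor_lift_pure cbilinear_legs)

lemma tensor_lift_diff:
  assumes "cbilinear f"
  shows "tensor_lift f (s - t) = tensor_lift f s - tensor_lift f t"
proof -
  have "tensor_lift f (s - t + t) = tensor_lift f (s - t) + tensor_lift f t"
    using tensor_lift_linear[OF assms] by (simp only: clinear_iff)
  then show ?thesis by simp
qed

lemma leg_diff: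
  "leg12 (s - t) = leg12 s - leg12 t"
  "leg13 (s - t) = leg13 s - leg13 t"
  "leg23 (s - t) = leg23 s - leg23 t"
  by (simp_all add: leg12_def leg13_def leg23_def tensor_lift_diff cbilinear_legs)

lemma pure_tensor_diff_left: "(x - y) \<otimes> b = x \<otimes> b - y \<otimes> b"
  using pure_tensor_add_left[of "x - y" y b] by (simp add: eq_diff_eq)

lemma pure_tensor_diff_right: "a \<otimes> (x - y) = a \<otimes> x - a \<otimes> y"
  using pure_tensor_add_right[of a "x - y" y] by (simp add: eq_diff_eq)

lemma pure_tensor_minus: "(- x) \<otimes> b = - (x \<otimes> b)" "a \<otimes> (- y) = - (a \<otimes> y)"
  using pure_tensor_scaleC_left[of "-1" x b] pure_tensor_scaleC_right[of a "-1" y] by simp_all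

lemma pure_tensor_zero: "0 \<otimes> b = 0" "a \<otimes> 0 = 0"
  using pure_tensor_scaleC_left[of 0 0 b] pure_tensor_scaleC_right[of a 0 0] by simp_all

lemma uea_incl_minus: "uea_incl (- x) = - uea_incl x"
  using uea_incl_scaleC[of "-1" x] by simp

lemma uea_incl_zero: "uea_incl 0 = 0"
  using uea_incl_scaleC[of 0 0] by simp

section \<open>The Yang-Baxter equation for bivectors\<close>

lemma commutator_diff:
  "commutator (a - b) c = commutator a c - commutator b c"
  "commutator a (b - c) = commutator a b - commutator a c"
  by (simp_all add: commutator_def algebra_simps)

text \<open>Two different legs share exactly one slot in which neither factor is 1. The products in
  the two orders differ only in that slot, where the commutator becomes the Lie bracket.\<close>

lemma commutator_legs:
  "commutator (leg12 (a \<otimes> b)) (leg13 (c \<otimes> d)) = uea_incl \<lbrakk>a, c\<rbrakk> \<otimes> uea_incl b \<otimes> uea_incl d"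
  "commutator (leg12 (a \<otimes> b)) (leg23 (c \<otimes> d)) = uea_incl a \<otimes> uea_incl \<lbrakk>b, c\<rbrakk> \<otimes> uea_incl d"
  "commutator (leg13 (a \<otimes> b)) (leg23 (c \<otimes> d)) = uea_incl a \<otimes> uea_incl c \<otimes> uea_incl \<lbrakk>b, d\<rbrakk>"
  by (simp_all add: leg_pure commutator_def tensor_mult_pure pure_tensor_diff_left
      pure_tensor_diff_right flip: commutator_uea_incl)

text \<open>Expansion gives twelve terms, six of which contain a bracket of \<open>x\<close> or
  \<open>y\<close> with itself. The others are multiples by \<open>c\<close> or \<open>- c\<close>
  of the words \<open>yyx\<close>, \<open>yxy\<close> and \<open>xyy\<close>; each word arises in
  two of the three commutators, with opposite signs.\<close>

lemma solves_CYBE_bivector: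
  fixes x y :: "'h::complex_lie_algebra"
  assumes "\<lbrakk>x, y\<rbrakk> = c *\<^sub>C y"
  shows "solves_CYBE (x \<otimes> y - y \<otimes> x)"
proof -
  have "\<lbrakk>y, x\<rbrakk> = - (c *\<^sub>C y)"
    using assms bracket_skew[of y x] by simp
  then show ?thesis
    unfolding solves_CYBE_def leg_diff commutator_diff commutator_legs
    by (simp add: assms bracket_self uea_incl_scaleC uea_incl_minus uea_incl_zero
        pure_tensor_linear pure_tensor_minus pure_tensor_zero)
qed

section \<open>The double of the three-dimensional algebra and its seven solutions\<close>

theorem proposition5p18:
  fixes e1 e2 e3 :: "'g::complex_lie_algebra"
    and f1 f2 f3 :: "'g cdual"
  assumes "is_cbasis [e1, e2, e3]"
    and "\<lbrakk>e1, e2\<rbrakk> = 0" and "\<lbrakk>e1, e3\<rbrakk> = 0" and "\<lbrakk>e2, e3\<rbrakk> = - e2"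
    and "is_dual_cbasis [e1, e2, e3] [f1, f2, f3]"
  shows "let E1 = of_alg e1; E2 = of_alg e2; E3 = of_alg e3;
             F1 = of_dual f1; F2 = of_dual f2; F3 = of_dual f3
    in
      is_cbasis [E1, E2, E3, F1, F2, F3] \<and>
      \<lbrakk>E2, E3\<rbrakk> = - E2 \<and> \<lbrakk>E2, F2\<rbrakk> = F3 \<and> \<lbrakk>E3, F2\<rbrakk> = - F2 \<and>
      \<lbrakk>E1, E2\<rbrakk> = 0 \<and> \<lbrakk>E1, E3\<rbrakk> = 0 \<and>
      \<lbrakk>E1, F1\<rbrakk> = 0 \<and> \<lbrakk>E1, F2\<rbrakk> = 0 \<and> \<lbrakk>E1, F3\<rbrakk> = 0 \<and>
      \<lbrakk>E2, F1\<rbrakk> = 0 \<and> \<lbrakk>E2, F3\<rbrakk> = 0 \<and>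
      \<lbrakk>E3, F1\<rbrakk> = 0 \<and> \<lbrakk>E3, F3\<rbrakk> = 0 \<and>
      \<lbrakk>F1, F2\<rbrakk> = 0 \<and> \<lbrakk>F1, F3\<rbrakk> = 0 \<and> \<lbrakk>F2, F3\<rbrakk> = 0 \<and>
      (\<forall>n32. solves_CYBE ((n32 *\<^sub>C E2) \<otimes> F3 - F3 \<otimes> (n32 *\<^sub>C E2))) \<and>
      (\<forall>n22 n23. n23 \<noteq> 0 \<longrightarrow>
        solves_CYBE
          ((n22 *\<^sub>C E2 + n23 *\<^sub>C E3) \<otimes> F2
           - ((n22\<^sup>2 / n23) *\<^sub>C E2 + n22 *\<^sub>C E3) \<otimes> F3
           - F2 \<otimes> (n22 *\<^sub>C E2 + n23 *\<^sub>C E3)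
           + F3 \<otimes> ((n22\<^sup>2 / n23) *\<^sub>C E2 + n22 *\<^sub>C E3))) \<and>
      (\<forall>n31 n32. n31 \<noteq> 0 \<longrightarrow>
        solves_CYBE
          ((n31 *\<^sub>C E1 + n32 *\<^sub>C E2) \<otimes> F3 - F3 \<otimes> (n31 *\<^sub>C E1 + n32 *\<^sub>C E2))) \<and>
      (\<forall>n21 n31. n21 \<noteq> 0 \<longrightarrow>
        solves_CYBE
          ((n21 *\<^sub>C E1) \<otimes> F2 + (n31 *\<^sub>C E1) \<otimes> F3
           - F2 \<otimes> (n21 *\<^sub>C E1) - F3 \<otimes> (n31 *\<^sub>C E1))) \<and>
      (\<forall>n12 n32. n12 \<noteq> 0 \<longrightarrow>
        solves_CYBE
          ((n12 *\<^sub>C E2) \<otimes> F1 + (n32 *\<^sub>C E2) \<otimes> F3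
           - F1 \<otimes> (n12 *\<^sub>C E2) - F3 \<otimes> (n32 *\<^sub>C E2))) \<and>
      (\<forall>n21 n31. n21 \<noteq> 0 \<longrightarrow>
        (let u = n21 *\<^sub>C E1 - n31 *\<^sub>C E2 + n21 *\<^sub>C E3;
             v = n31 *\<^sub>C E1 - (n31\<^sup>2 / n21) *\<^sub>C E2 + n31 *\<^sub>C E3
         in solves_CYBE (u \<otimes> F2 + v \<otimes> F3 - F2 \<otimes> u - F3 \<otimes> v))) \<and>
      (\<forall>n21 n33. n21 \<noteq> 0 \<longrightarrow>
        (let u = n21 *\<^sub>C E1 - n33 *\<^sub>C E2 - n21 *\<^sub>C E3;
             v = - n33 *\<^sub>C E1 + (n33\<^sup>2 / n21) *\<^sub>C E2 + n33 *\<^sub>C E3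
         in solves_CYBE (u \<otimes> F2 + v \<otimes> F3 - F2 \<otimes> u - F3 \<otimes> v)))"
proof -
  have brackets_g: "\<lbrakk>e2, e1\<rbrakk> = 0" "\<lbrakk>e3, e1\<rbrakk> = 0" "\<lbrakk>e3, e2\<rbrakk> = e2"
    using assms(2-4) bracket_skew[of e2 e1] bracket_skew[of e3 e1] bracket_skew[of e3 e2]
    by simp_all
  have pairings: "pairing f1 e1 = 1" "pairing f1 e2 = 0" "pairing f1 e3 = 0"
    "pairing f2 e1 = 0" "pairing f2 e2 = 1" "pairing f2 e3 = 0"
    "pairing f3 e1 = 0" "pairing f3 e2 = 0" "pairing f3 e3 = 1"
    using assms(5) by (simp_all add: is_dual_cbasis_def All_less_Suc)
  \<comment> \<open>All brackets are multiples of \<open>e2\<close>, on which only \<open>f2\<close>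
    is non-zero. The two non-zero results come from evaluating \<open>coadjoint e2 f2\<close> at
    \<open>e3\<close> and \<open>coadjoint e3 f2\<close> at \<open>e2\<close>.\<close>
  have coadjoints: "coadjoint e1 f1 = 0" "coadjoint e1 f2 = 0" "coadjoint e1 f3 = 0"
    "coadjoint e2 f1 = 0" "coadjoint e2 f2 = f3" "coadjoint e2 f3 = 0"
    "coadjoint e3 f1 = 0" "coadjoint e3 f2 = - f2" "coadjoint e3 f3 = 0"
    by (rule cdual_eqI_basis[OF assms(1)];
        auto simp: pairing_coadjoint zero_cdual.rep_eq uminus_cdual.rep_eq pairings
          assms(2-4) brackets_g bracket_self)+
  have coadjoint_0: "coadjoint x 0 = 0" "coadjoint 0 \<xi> = 0" for x :: 'g and \<xi>
    by (rule cdual_eqI; simp add: pairing_coadjoint zero_cdual.rep_eq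
        bracket_scaleC_left[of 0 0, simplified])+
  have bracket_0: "\<lbrakk>0, x\<rbrakk> = 0" "\<lbrakk>x, 0\<rbrakk> = 0" for x :: 'g
    using bracket_scaleC_left[of 0 0 x] bracket_scaleC_right[of x 0 0] by simp_all
  define E1 E2 E3 F1 F2 F3 where EF: "E1 = of_alg e1" "E2 = of_alg e2" "E3 = of_alg e3"
    "F1 = of_dual f1" "F2 = of_dual f2" "F3 = of_dual f3"
  have basis: "is_cbasis [E1, E2, E3, F1, F2, F3]"
    using is_cbasis_coadj_double[OF assms(5)] by (simp add: EF)
  have brackets: "\<lbrakk>E2, E3\<rbrakk> = - E2" "\<lbrakk>E2, F2\<rbrakk> = F3" "\<lbrakk>E3, F2\<rbrakk> = - F2"
    "\<lbrakk>E1, E2\<rbrakk> = 0" "\<lbrakk>E1, E3\<rbrakk> = 0" "\<lbrakk>E1, F1\<rbrakk> = 0" "\<lbrakk>E1, F2\<rbrakk> = 0" "\<lbrakk>E1, F3\<rbrakk> = 0"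
    "\<lbrakk>E2, F1\<rbrakk> = 0" "\<lbrakk>E2, F3\<rbrakk> = 0" "\<lbrakk>E3, F1\<rbrakk> = 0" "\<lbrakk>E3, F3\<rbrakk> = 0"
    "\<lbrakk>F1, F2\<rbrakk> = 0" "\<lbrakk>F1, F3\<rbrakk> = 0" "\<lbrakk>F2, F3\<rbrakk> = 0"
    by (simp_all add: EF lie_bracket_coadj_double_def zero_coadj_double_def
        uminus_coadj_double_def assms(2-4) coadjoints coadjoint_0 bracket_0)
  have bracket_uminus: "\<lbrakk>- x, y\<rbrakk> = - \<lbrakk>x, y\<rbrakk>" for x y :: "'g coadj_double"
    using bracket_scaleC_left[of "-1" x y] by simp
  have bracket_diff: "\<lbrakk>x, y - z\<rbrakk> = \<lbrakk>x, y\<rbrakk> - \<lbrakk>x, z\<rbrakk>" for x y z :: "'g coadj_double"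
    using bracket_add_right[of x "y - z" z] by (simp add: eq_diff_eq)
  note bracket_linear = bracket_add_left bracket_add_right bracket_scaleC_left
    bracket_scaleC_right bracket_uminus bracket_diff
  note tensor_linear = pure_tensor_linear pure_tensor_minus pure_tensor_diff_left pure_tensor_diff_right
  note scale = scaleC_add_right scaleC_scaleC cvec.scale_right_diff_distrib
  have r1: "solves_CYBE ((n32 *\<^sub>C E2) \<otimes> F3 - F3 \<otimes> (n32 *\<^sub>C E2))" for n32
    \<comment> \<open>The factor 0 says that the two vectors commute, here \<open>E2\<close> and
      \<open>F3\<close>.\<close>
    by (rule solves_CYBE_bivector[of _ _ 0]) (simp add: bracket_linear brackets)
  have r2: "solves_CYBE
          ((n22 *\<^sub>C E2 + n23 *\<^sub>C E3) \<otimes> F2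
           - ((n22\<^sup>2 / n23) *\<^sub>C E2 + n22 *\<^sub>C E3) \<otimes> F3
           - F2 \<otimes> (n22 *\<^sub>C E2 + n23 *\<^sub>C E3)
           + F3 \<otimes> ((n22\<^sup>2 / n23) *\<^sub>C E2 + n22 *\<^sub>C E3))" if "n23 \<noteq> 0" for n22 n23
  proof -
    \<comment> \<open>The vector paired with \<open>F3\<close> is \<open>n22 / n23\<close> times
      \<open>?x\<close>; moving this scalar across the tensor sign turns the whole expression into
      one bivector.\<close>
    let ?x = "n22 *\<^sub>C E2 + n23 *\<^sub>C E3" and ?y = "F2 + (- n22 / n23) *\<^sub>C F3"
    have "\<lbrakk>?x, ?y\<rbrakk> = (- n23) *\<^sub>C ?y"
      using that by (simp add: bracket_linear brackets scale)
    from solves_CYBE_bivector[OF this] show ?thesis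
      using that by (simp add: tensor_linear scale power2_eq_square algebra_simps)
  qed
  have r3: "solves_CYBE
      ((n31 *\<^sub>C E1 + n32 *\<^sub>C E2) \<otimes> F3 - F3 \<otimes> (n31 *\<^sub>C E1 + n32 *\<^sub>C E2))" for n31 n32
    by (rule solves_CYBE_bivector[of _ _ 0]) (simp add: bracket_linear brackets)
  have r4: "solves_CYBE ((n21 *\<^sub>C E1) \<otimes> F2 + (n31 *\<^sub>C E1) \<otimes> F3
      - F2 \<otimes> (n21 *\<^sub>C E1) - F3 \<otimes> (n31 *\<^sub>C E1))" for n21 n31
    \<comment> \<open>Both terms share the factor \<open>E1\<close>, which commutes with
      \<open>F2\<close> and \<open>F3\<close>; the parameters move to the dual side.\<close>
    using solves_CYBE_bivector[of E1 "n21 *\<^sub>C F2 + n31 *\<^sub>C F3" 0]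
    by (simp add: bracket_linear brackets tensor_linear algebra_simps)
  have r5: "solves_CYBE ((n12 *\<^sub>C E2) \<otimes> F1 + (n32 *\<^sub>C E2) \<otimes> F3
      - F1 \<otimes> (n12 *\<^sub>C E2) - F3 \<otimes> (n32 *\<^sub>C E2))" for n12 n32
    \<comment> \<open>Same regrouping, with \<open>E2\<close> commuting with \<open>F1\<close> and
      \<open>F3\<close>.\<close>
    using solves_CYBE_bivector[of E2 "n12 *\<^sub>C F1 + n32 *\<^sub>C F3" 0]
    by (simp add: bracket_linear brackets tensor_linear algebra_simps)
  \<comment> \<open>Common form of the last two families: since \<open>v\<close> is proportional to
    \<open>u\<close>, the tensor is the bivector of \<open>u\<close> and \<open>?y\<close>. The
    ratio \<open>- b / c\<close> makes \<open>?y\<close> an eigenvector, as bracketing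
    \<open>u\<close> with \<open>F2\<close> gives \<open>b\<close> times \<open>F3\<close> minus
    \<open>c\<close> times \<open>F2\<close>.\<close>
  have r67: "solves_CYBE (u \<otimes> F2 + v \<otimes> F3 - F2 \<otimes> u - F3 \<otimes> v)"
    if "c \<noteq> 0" "u = a *\<^sub>C E1 + b *\<^sub>C E2 + c *\<^sub>C E3" "v = (- b / c) *\<^sub>C u" for a b c u v
  proof -
    let ?y = "F2 + (- b / c) *\<^sub>C F3"
    have "\<lbrakk>u, ?y\<rbrakk> = (- c) *\<^sub>C ?y"
      using that(1,2) by (simp add: bracket_linear brackets scale)
    from solves_CYBE_bivector[OF this] show ?thesis
      using that(1,3) by (simp add: tensor_linear scale algebra_simps)
  qed
  have r6: "let u = n21 *\<^sub>C E1 - n31 *\<^sub>C E2 + n21 *\<^sub>C E3;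
             v = n31 *\<^sub>C E1 - (n31\<^sup>2 / n21) *\<^sub>C E2 + n31 *\<^sub>C E3
         in solves_CYBE (u \<otimes> F2 + v \<otimes> F3 - F2 \<otimes> u - F3 \<otimes> v)" if "n21 \<noteq> 0" for n21 n31
    unfolding Let_def using that
    \<comment> \<open>The positional arguments are \<open>c\<close>, \<open>u\<close>,
      \<open>a\<close>, \<open>b\<close>; the ratio of \<open>v\<close> to \<open>u\<close> is
      \<open>n31 / n21\<close>.\<close>
    by (intro r67[of n21 _ n21 "- n31"]) (simp_all add: scale power2_eq_square)
  have r7: "let u = n21 *\<^sub>C E1 - n33 *\<^sub>C E2 - n21 *\<^sub>C E3;
             v = - n33 *\<^sub>C E1 + (n33\<^sup>2 / n21) *\<^sub>C E2 + n33 *\<^sub>C E3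
         in solves_CYBE (u \<otimes> F2 + v \<otimes> F3 - F2 \<otimes> u - F3 \<otimes> v)" if "n21 \<noteq> 0" for n21 n33
    unfolding Let_def using that
    \<comment> \<open>Here \<open>c\<close> is \<open>- n21\<close>, so the ratio of
      \<open>v\<close> to \<open>u\<close> is \<open>- n33 / n21\<close>.\<close>
    by (intro r67[of "- n21" _ n21 "- n33"]) (simp_all add: scale power2_eq_square)
  show ?thesis
    unfolding Let_def EF[symmetric]
    by (intro conjI allI impI basis brackets r1 r2 r3 r4 r5 r6[unfolded Let_def]
        r7[unfolded Let_def])
qed

end
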